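(* Let $0<q<1$, $n\ge1$, and let $\lambda=(\lambda_1,\dots,\lambda_n)$, $\mu=(\mu_1,\dots,\mu_n)$ be partitions with at most $n$ parts. Then \[ \sum_{\substack{T\in\mathrm{RPP}((\delta_{n+1}+\lambda)^* )\\ \mathrm{rdiag}(T)=\mu}}q^{|T|}=\frac{q^{-b(\delta_{n+1}+\lambda)}}{\prod_{j=1}^n(q;q)_{\lambda_j+n-j}}\,q^{|\mu+\delta_n|}\,s_\lambda(q^{\mu+\delta_n})\,\overline\Delta(q^{\mu+\delta_n}). \]
   Context: $\delta_n=(n-1,n-2,\dots,0)$, $\delta_{n+1}=(n,n-1,\dots,1)$. The shifted diagram $(\delta_{n+1}+\lambda)^*$ consists of the cells $(i,j)$ with $1\le i\le n$ and $i\le j\le n+\lambda_i$. A reverse plane partition of this shape is a filling of its cells by nonnegative integers weakly increasing along rows (left to right) and columns (top to bottom); $\mathrm{RPP}(\cdot)$ is the set of these, $|T|$ the sum of entries, and $\mathrm{rdiag}(T)=(T(n,n),T(n-1,n-1),\dots,T(1,1))$. For a sequence $\nu$, $b(\nu)=\sum_i(i-1)\nu_i$ and $|\nu|=\sum_i\nu_i$. $q^{\mu+\delta_n}=(q^{\mu_1+n-1},q^{\mu_2+n-2},\dots,q^{\mu_n})$. $s_\lambda(x_1,\dots,x_n)=\det(x_j^{\lambda_i+n-i})/\det(x_j^{n-i})$ is the Schur polynomial, $\overline\Delta(x)=\prod_{1\le i<j\le n}(x_j-x_i)$, and $(q;q)_k=\prod_{l=1}^k(1-q^l)$. *)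

theory Defs
  imports "HOL-Analysis.Infinite_Sum" "Jordan_Normal_Form.Determinant"
begin

text \<open>
  A sequence of length \<open>n\<close> is a function on \<^typ>\<open>nat\<close> of which only the values at \<open>1, \<dots>, n\<close>
  matter. Partitions and \<open>rdiag\<close> are set to \<open>0\<close> elsewhere, so that equality of functions is
  equality of sequences.
\<close>

definition partitions :: "nat \<Rightarrow> (nat \<Rightarrow> nat) set" where
  "partitions n = {lam. (\<forall>i j. 1 \<le> i \<and> i \<le> j \<and> j \<le> n \<longrightarrow> lam j \<le> lam i) \<and>
                        (\<forall>i. i \<notin> {1..n} \<longrightarrow> lam i = 0)}"

text \<open>
  \<open>\<delta>\<^sub>m = (m - 1, m - 2, \<dots>)\<close>; truncated subtraction gives \<open>0\<close> from index \<open>m\<close> on.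
\<close>

definition delta :: "nat \<Rightarrow> nat \<Rightarrow> nat" where
  "delta m i = m - i"

definition seq_size :: "nat \<Rightarrow> (nat \<Rightarrow> nat) \<Rightarrow> nat" where
  "seq_size n \<nu> = (\<Sum>i=1..n. \<nu> i)"

definition seq_b :: "nat \<Rightarrow> (nat \<Rightarrow> nat) \<Rightarrow> nat" where
  "seq_b n \<nu> = (\<Sum>i=1..n. (i - 1) * \<nu> i)"

text \<open>
  The shifted diagram \<open>(\<delta>\<^sub>n\<^sub>+\<^sub>1 + \<lambda>)\<^sup>*\<close>: row \<open>i\<close> has \<open>n + 1 - i + \<lambda>\<^sub>i\<close> cells and starts in
  column \<open>i\<close>.
\<close>

definition shifted_diagram :: "nat \<Rightarrow> (nat \<Rightarrow> nat) \<Rightarrow> (nat \<times> nat) set" where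
  "shifted_diagram n lam = {(i, j). 1 \<le> i \<and> i \<le> n \<and> i \<le> j \<and> j \<le> n + lam i}"

text \<open>
  A filling of the cells \<open>D\<close> is a total function that is set to \<open>0\<close> off \<open>D\<close>, so that distinct
  elements of \<open>RPP D\<close> are distinct fillings.
\<close>

definition RPP :: "(nat \<times> nat) set \<Rightarrow> (nat \<times> nat \<Rightarrow> nat) set" where
  "RPP D = {T. (\<forall>c. c \<notin> D \<longrightarrow> T c = 0) \<and>
               (\<forall>i j j'. (i, j) \<in> D \<and> (i, j') \<in> D \<and> j \<le> j' \<longrightarrow> T (i, j) \<le> T (i, j')) \<and>
               (\<forall>i i' j. (i, j) \<in> D \<and> (i', j) \<in> D \<and> i \<le> i' \<longrightarrow> T (i, j) \<le> T (i', j))}"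

definition RPP_size :: "(nat \<times> nat) set \<Rightarrow> (nat \<times> nat \<Rightarrow> nat) \<Rightarrow> nat" where
  "RPP_size D T = (\<Sum>c\<in>D. T c)"

definition rdiag :: "nat \<Rightarrow> (nat \<times> nat \<Rightarrow> nat) \<Rightarrow> nat \<Rightarrow> nat" where
  "rdiag n T i = (if i \<in> {1..n} then T (n + 1 - i, n + 1 - i) else 0)"

text \<open>
  The bialternant \<open>det (x\<^sub>j ^ (\<lambda>\<^sub>i + n - i)) / det (x\<^sub>j ^ (n - i))\<close>; matrix indices start at \<open>0\<close>.
  It is the value of the Schur polynomial only where \<open>x 1, \<dots>, x n\<close> are distinct; otherwise
  the quotient is \<open>0\<close> by convention.
\<close>

definition schur :: "nat \<Rightarrow> (nat \<Rightarrow> nat) \<Rightarrow> (nat \<Rightarrow> 'a) \<Rightarrow> 'a :: field" where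
  "schur n lam x =
     det (mat n n (\<lambda>(i, j). x (j + 1) ^ (lam (i + 1) + n - (i + 1)))) /
     det (mat n n (\<lambda>(i, j). x (j + 1) ^ (n - (i + 1))))"

definition vandermonde_bar :: "nat \<Rightarrow> (nat \<Rightarrow> 'a) \<Rightarrow> 'a :: comm_ring_1" where
  "vandermonde_bar n x = (\<Prod>(i, j)\<in>{(i, j). 1 \<le> i \<and> i < j \<and> j \<le> n}. x j - x i)"

text \<open>The \<open>q\<close>-Pochhammer symbol \<open>(q; q)\<^sub>k\<close>.\<close>

definition q_poch :: "'a \<Rightarrow> nat \<Rightarrow> 'a :: comm_ring_1" where
  "q_poch q k = (\<Prod>l=1..k. 1 - q ^ l)"

end

theory Submission
  imports Defs "HOL-Analysis.Elementary_Metric_Spaces"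
begin

text \<open>
  Write \<open>a\<^sub>i = \<lambda>\<^sub>i + n - i\<close> and, for a filling with main diagonal \<open>d\<close>, \<open>t\<^sub>j = d\<^sub>j + j - 1\<close>. Deleting the
  main diagonal leaves a filling of the shape with every \<open>a\<^sub>i\<close> decreased by one (the last row
  disappears if \<open>a\<^sub>n = 0\<close>), whose main diagonal interlaces \<open>d\<close>: each of its \<open>t'\<^sub>j\<close> ranges over
  \<open>[t\<^sub>j, t\<^sub>j\<^sub>+\<^sub>1)\<close>, independently of the others, where \<open>t\<^sub>n\<^sub>+\<^sub>1 = \<infinity>\<close>. By induction the generating function is
  \<open>det (q^(t\<^sub>j a\<^sub>i))\<close> up to explicit factors: the determinant is multilinear in its columns, the sum
  over \<open>t'\<^sub>j\<close> is geometric with value \<open>(q^(t\<^sub>j a\<^sub>i) - q^(t\<^sub>j\<^sub>+\<^sub>1 a\<^sub>i)) / (1 - q^a\<^sub>i)\<close>, and column operations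
  remove the differences. The Vandermonde determinant turns \<open>det (q^(t\<^sub>j a\<^sub>i))\<close> into the Schur
  polynomial times the product of differences.
\<close>

section \<open>Sums over products of index sets\<close>

lemma has_sum_sum_finite:
  fixes f :: "'a \<Rightarrow> 'b \<Rightarrow> 'c :: topological_comm_monoid_add"
  assumes "finite A" "\<And>a. a \<in> A \<Longrightarrow> (f a has_sum s a) B"
  shows "((\<lambda>x. \<Sum>a\<in>A. f a x) has_sum (\<Sum>a\<in>A. s a)) B"
  using assms by (induction A rule: finite_induct) (auto intro!: has_sum_add)

text \<open>Fubini by induction on \<open>A\<close>: a function on \<open>insert x A\<close> amounts
  to its value at \<open>x\<close> together with a function on \<open>A\<close>. As the factors are
  nonnegative, convergence of the iterated sums gives summability over the pairs.\<close>

lemma has_sum_prod_PiE_nonneg: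
  fixes f :: "'a \<Rightarrow> 'b \<Rightarrow> real"
  assumes "finite A"
    and "\<And>x. x \<in> A \<Longrightarrow> (f x has_sum s x) (B x)"
    and "\<And>x y. x \<in> A \<Longrightarrow> y \<in> B x \<Longrightarrow> 0 \<le> f x y"
  shows "((\<lambda>g. \<Prod>x\<in>A. f x (g x)) has_sum (\<Prod>x\<in>A. s x)) (PiE A B)"
  using assms
proof (induction A rule: finite_induct)
  case empty
  show ?case by (simp add: has_sum_finiteI)
next
  case (insert x A)
  let ?P = "\<lambda>g. \<Prod>y\<in>A. f y (g y)"
  have IH: "(?P has_sum (\<Prod>y\<in>A. s y)) (PiE A B)"
    using insert.IH insert.prems by auto
  have P_nonneg: "0 \<le> ?P g" if "g \<in> PiE A B" for g
    using that insert.prems(2) by (intro prod_nonneg) (auto simp: PiE_mem)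
  have inner: "((\<lambda>g. f x y * ?P g) has_sum f x y * (\<Prod>y\<in>A. s y)) (PiE A B)" for y
    by (rule has_sum_cmult_right[OF IH])
  have outer: "((\<lambda>y. f x y * (\<Prod>y\<in>A. s y)) has_sum s x * (\<Prod>y\<in>A. s y)) (B x)"
    by (rule has_sum_cmult_left) (simp add: insert.prems(1))
  have "((\<lambda>(y, g). f x y * ?P g) has_sum s x * (\<Prod>y\<in>A. s y)) (B x \<times> PiE A B)"
  proof (rule has_sum_SigmaI)
    show "(\<lambda>(y, g). f x y * ?P g) summable_on B x \<times> PiE A B"
      by (rule summable_on_SigmaI[OF _ has_sum_imp_summable[OF outer]])
        (use inner insert.prems(2) P_nonneg in auto)
  qed (use inner outer in auto)
  \<comment> \<open>Members of \<open>PiE A B\<close> are \<open>undefined\<close> at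
    \<open>x\<close>, so setting the value at \<open>x\<close> and resetting it to
    \<open>undefined\<close> are inverse to each other.\<close>
  also have "?this \<longleftrightarrow> ((\<lambda>g. \<Prod>y\<in>insert x A. f y (g y)) has_sum s x * (\<Prod>y\<in>A. s y))
      (PiE (insert x A) B)"
  proof (rule has_sum_reindex_bij_witness)
    fix a assume "a \<in> B x \<times> PiE A B"
    then obtain y g where a: "a = (y, g)" "y \<in> B x" "g \<in> PiE A B" by auto
    then have gx: "g x = undefined"
      using insert.hyps(2) by (auto simp: PiE_def extensional_def)
    let ?j = "\<lambda>(y, g). g(x := y)"
    let ?i = "\<lambda>g. (g x, g(x := undefined))"
    show "?i (?j a) = a" using a gx by auto
    show "?j a \<in> PiE (insert x A) B"
      using a by (auto simp: PiE_def extensional_def)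
    have "(\<Prod>y'\<in>A. f y' ((g(x := y)) y')) = ?P g"
      by (rule prod.cong) (use insert.hyps(2) in auto)
    then show "(\<Prod>y\<in>insert x A. f y (?j a y)) = (\<lambda>(y, g). f x y * ?P g) a"
      using a insert.hyps by simp
  next
    fix g assume "g \<in> PiE (insert x A) B"
    then show "(\<lambda>g. (g x, g(x := undefined))) g \<in> B x \<times> PiE A B"
      using insert.hyps(2) by (auto simp: PiE_def extensional_def)
  qed auto
  finally show ?case using insert.hyps by simp
qed

text \<open>In a Leibniz term, \<open>e j\<close> enters only the factor taken from column
  \<open>j\<close>, so the sum over \<open>e\<close> factors column by column. The signs stay
  outside the products, which are therefore nonnegative.\<close>

lemma has_sum_det_columns:
  fixes g :: "nat \<Rightarrow> nat \<Rightarrow> 'b \<Rightarrow> real"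
  assumes "\<And>i j. i < n \<Longrightarrow> j < n \<Longrightarrow> (g i j has_sum s i j) (B j)"
    and "\<And>i j x. i < n \<Longrightarrow> j < n \<Longrightarrow> x \<in> B j \<Longrightarrow> 0 \<le> g i j x"
  shows "((\<lambda>e. det (mat n n (\<lambda>(i, j). g i j (e j)))) has_sum det (mat n n (\<lambda>(i, j). s i j)))
    (PiE {..<n} B)"
proof -
  have det: "det (mat n n (\<lambda>(i, j). h i j)) =
      (\<Sum>p | p permutes {0..<n}. signof p * (\<Prod>j<n. h (p j) j))" for h :: "nat \<Rightarrow> nat \<Rightarrow> real"
    by (subst det_col[of _ n]) (auto intro!: sum.cong prod.cong simp: permutes_in_image[of _ "{0..<n}", simplified])
  have "((\<lambda>e. \<Prod>j<n. g (p j) j (e j)) has_sum (\<Prod>j<n. s (p j) j)) (PiE {..<n} B)"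
    if p: "p permutes {0..<n}" for p
  proof -
    have "p j < n" if "j < n" for j
      using permutes_in_image[OF p, of j] that by simp
    then show ?thesis
      using assms by (intro has_sum_prod_PiE_nonneg) auto
  qed
  then show ?thesis
    unfolding det by (intro has_sum_sum_finite has_sum_cmult_right) (auto simp: finite_permutations)
qed

section \<open>Determinant identities\<close>

text \<open>Each Leibniz term takes exactly one entry from every row and every column.\<close>

lemma det_scale:
  fixes f :: "nat \<Rightarrow> nat \<Rightarrow> 'a :: comm_ring_1"
  shows "det (mat n n (\<lambda>(i, j). r i * c j * f i j)) =
    (\<Prod>i<n. r i) * (\<Prod>j<n. c j) * det (mat n n (\<lambda>(i, j). f i j))"
proof -
  have "signof p * (\<Prod>j<n. mat n n (\<lambda>(i, j). r i * c j * f i j) $$ (p j, j)) =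
      (\<Prod>i<n. r i) * (\<Prod>j<n. c j) * (signof p * (\<Prod>j<n. mat n n (\<lambda>(i, j). f i j) $$ (p j, j)))"
    if p: "p permutes {0..<n}" for p
  proof -
    have [simp]: "p j < n" if "j < n" for j
      using permutes_in_image[OF p, of j] that by simp
    have r: "(\<Prod>j<n. r (p j)) = (\<Prod>i<n. r i)"
      using prod.permute[of p "{..<n}" r] p by (simp add: atLeast0LessThan o_def)
    have "(\<Prod>j<n. mat n n (\<lambda>(i, j). r i * c j * f i j) $$ (p j, j)) =
        (\<Prod>j<n. r (p j) * c j * f (p j) j)"
      by (intro prod.cong) auto
    also have "\<dots> = (\<Prod>i<n. r i) * (\<Prod>j<n. c j) * (\<Prod>j<n. f (p j) j)"
      by (simp add: prod.distrib r)
    also have "(\<Prod>j<n. f (p j) j) = (\<Prod>j<n. mat n n (\<lambda>(i, j). f i j) $$ (p j, j))"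
      by (intro prod.cong) auto
    finally show ?thesis by (simp add: ac_simps)
  qed
  then show ?thesis
    by (simp add: det_col[of _ n] sum_distrib_left)
qed

lemma det_last_row:
  fixes f :: "nat \<Rightarrow> nat \<Rightarrow> 'a :: comm_ring_1"
  assumes "\<And>j. j < n \<Longrightarrow> f n j = 0"
  shows "det (mat (Suc n) (Suc n) (\<lambda>(i, j). f i j)) = f n n * det (mat n n (\<lambda>(i, j). f i j))"
proof -
  let ?A = "mat (Suc n) (Suc n) (\<lambda>(i, j). f i j)"
  have "det ?A = (\<Sum>j<Suc n. ?A $$ (n, j) * cofactor ?A n j)"
    by (rule laplace_expansion_row) auto
  also have "\<dots> = f n n * cofactor ?A n n"
    using assms by simp
  also have "mat_delete ?A n n = mat n n (\<lambda>(i, j). f i j)"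
    by (auto simp: mat_delete_def)
  then have "cofactor ?A n n = det (mat n n (\<lambda>(i, j). f i j))"
    by (simp add: cofactor_def flip: mult_2)
  finally show ?thesis .
qed

lemma det_last_column:
  fixes f :: "nat \<Rightarrow> nat \<Rightarrow> 'a :: comm_ring_1"
  assumes "\<And>i. i < n \<Longrightarrow> f i n = 0"
  shows "det (mat (Suc n) (Suc n) (\<lambda>(i, j). f i j)) = f n n * det (mat n n (\<lambda>(i, j). f i j))"
proof -
  have tr: "det (mat m m (\<lambda>(i, j). f i j)) = det (mat m m (\<lambda>(i, j). f j i))" for m
    by (subst det_transpose[of _ m, symmetric]) (auto intro!: arg_cong[of _ _ det])
  show ?thesis
    unfolding tr by (rule det_last_row[of n "\<lambda>i j. f j i"]) (use assms in auto)
qed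

text \<open>The column operations are right multiplication by the unitriangular matrix
  \<open>?L\<close>. The last column stays as it is, matching \<open>t_(n+1) = \<infinity>\<close>,
  where the subtracted power of \<open>q\<close> vanishes.\<close>

lemma det_diff_next_column:
  fixes f :: "nat \<Rightarrow> nat \<Rightarrow> 'a :: idom"
  shows "det (mat n n (\<lambda>(i, j). f i j - (if Suc j < n then f i (Suc j) else 0))) =
    det (mat n n (\<lambda>(i, j). f i j))"
proof -
  let ?L = "mat n n (\<lambda>(i, j). if i = j then 1 else if i = Suc j then -1 else 0 :: 'a)"
  have "det ?L = prod_list (diag_mat ?L)"
    by (rule det_lower_triangular[of n]) auto
  also have "\<dots> = 1"
    by (auto simp: prod_list_diag_prod)
  finally have L: "det ?L = 1" .
  have "mat n n (\<lambda>(i, j). f i j - (if Suc j < n then f i (Suc j) else 0)) =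
      mat n n (\<lambda>(i, j). f i j) * ?L"
  proof (rule eq_matI, simp_all, goal_cases)
    case (1 i j)
    have "(\<Sum>k = 0..<n. f i k * (if k = j then 1 else if k = Suc j then - 1 else 0)) =
        (\<Sum>k = 0..<n. (if k = j then f i k else 0) - (if k = Suc j then f i k else 0))"
      by (intro sum.cong) auto
    also have "\<dots> = f i j - (if Suc j < n then f i (Suc j) else 0)"
      using 1 by (simp add: sum_subtractf)
    finally show ?case using 1 by (simp add: scalar_prod_def)
  qed
  then show ?thesis
    by (simp add: det_mult[of _ n] L)
qed

text \<open>This serves the case where the last exponent is 0. Column differences turn the row of
  ones into \<open>(0, ..., 0, 1)\<close>, and expansion along it removes the last row and
  column.\<close>

lemma det_diff_next_column_last_row:
  fixes f :: "nat \<Rightarrow> nat \<Rightarrow> 'a :: idom"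
  assumes "\<And>j. j \<le> n \<Longrightarrow> f n j = 1"
  shows "det (mat n n (\<lambda>(i, j). f i j - f i (Suc j))) = det (mat (Suc n) (Suc n) (\<lambda>(i, j). f i j))"
proof -
  let ?g = "\<lambda>i j. f i j - (if Suc j < Suc n then f i (Suc j) else 0)"
  have "det (mat (Suc n) (Suc n) (\<lambda>(i, j). ?g i j)) = ?g n n * det (mat n n (\<lambda>(i, j). ?g i j))"
    by (rule det_last_row) (use assms in auto)
  also have "mat n n (\<lambda>(i, j). ?g i j) = mat n n (\<lambda>(i, j). f i j - f i (Suc j))"
    by auto
  finally show ?thesis
    using det_diff_next_column[of "Suc n" f] assms[of n] by simp
qed

text \<open>Left multiplication by \<open>?U\<close> subtracts \<open>y n\<close> times the next row
  from every row but the last. Above the last row, this produces a factor \<open>y j - y n\<close>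
  in column \<open>j\<close>.\<close>

lemma det_vandermonde:
  fixes y :: "nat \<Rightarrow> 'a :: idom"
  shows "det (mat n n (\<lambda>(i, j). y j ^ (n - 1 - i))) = (\<Prod>j<n. \<Prod>i<j. y i - y j)"
proof (induction n)
  case 0
  show ?case by simp
next
  case (Suc n)
  let ?f = "\<lambda>i j. y j ^ (n - i) - (if Suc i < Suc n then y n * y j ^ (n - Suc i) else 0)"
  let ?U = "mat (Suc n) (Suc n) (\<lambda>(i, j). if i = j then 1 else if j = Suc i then - y n else 0)"
  let ?V = "mat (Suc n) (Suc n) (\<lambda>(i, j). y j ^ (n - i))"
  have "det ?U = prod_list (diag_mat ?U)"
    by (rule det_upper_triangular[of _ "Suc n"]) auto
  also have "\<dots> = 1"
    by (auto simp: prod_list_diag_prod)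
  finally have U: "det ?U = 1" .
  have UV: "mat (Suc n) (Suc n) (\<lambda>(i, j). ?f i j) = ?U * ?V"
  proof (rule eq_matI, simp_all del: upt_Suc, goal_cases)
    case (1 i j)
    have "(\<Sum>k = 0..<Suc n. (if i = k then 1 else if k = Suc i then - y n else 0) * y j ^ (n - k)) =
        (\<Sum>k = 0..<Suc n. (if k = i then y j ^ (n - k) else 0) - (if k = Suc i then y n * y j ^ (n - k) else 0))"
      by (intro sum.cong) auto
    also have "\<dots> = ?f i j"
      using 1 by (simp add: sum_subtractf del: sum.op_ivl_Suc)
    finally show ?case using 1 by (simp add: scalar_prod_def del: sum.op_ivl_Suc)
  qed
  \<comment> \<open>At \<open>j = n\<close> this vanishes, so the last column is 0 except for its
    corner entry \<open>?f n n = 1\<close>.\<close>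
  have pow: "?f i j = (y j - y n) * y j ^ (n - 1 - i)" if "i < n" for i j
    using that by (simp add: Suc_diff_Suc left_diff_distrib flip: power_Suc)
  have "det ?V = det (mat (Suc n) (Suc n) (\<lambda>(i, j). ?f i j))"
    unfolding UV by (simp add: det_mult[of _ "Suc n"] U)
  also have "\<dots> = ?f n n * det (mat n n (\<lambda>(i, j). ?f i j))"
    by (rule det_last_column) (simp only: pow, simp)
  also have "mat n n (\<lambda>(i, j). ?f i j) = mat n n (\<lambda>(i, j). 1 * (y j - y n) * y j ^ (n - 1 - i))"
    by (rule eq_matI) (auto simp: Suc_diff_Suc left_diff_distrib simp flip: power_Suc)
  also have "det \<dots> = (\<Prod>j<n. y j - y n) * det (mat n n (\<lambda>(i, j). y j ^ (n - 1 - i)))"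
    by (subst det_scale) simp
  finally show ?case using Suc.IH by (simp add: mult.commute)
qed

text \<open>The point is that one factor \<open>c\<close>, the determinant of the reversal matrix,
  serves all \<open>f\<close>: it can then be transferred between the two determinants of the
  bialternant.\<close>

lemma det_reverse_columns:
  "\<exists>c. \<forall>f :: nat \<Rightarrow> nat \<Rightarrow> 'a :: idom.
    det (mat n n (\<lambda>(i, j). f i (n - 1 - j))) = c * det (mat n n (\<lambda>(i, j). f i j))"
proof (intro exI allI)
  fix f :: "nat \<Rightarrow> nat \<Rightarrow> 'a"
  let ?R = "mat n n (\<lambda>(i, j). if i = n - 1 - j then 1 else 0 :: 'a)"
  have "mat n n (\<lambda>(i, j). f i (n - 1 - j)) = mat n n (\<lambda>(i, j). f i j) * ?R"
    by (rule eq_matI) (auto simp: scalar_prod_def if_distrib cong: if_cong)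
  then show "det (mat n n (\<lambda>(i, j). f i (n - 1 - j))) = det ?R * det (mat n n (\<lambda>(i, j). f i j))"
    by (simp only: det_mult[of _ n] mat_carrier mult.commute)
qed

section \<open>Geometric sums\<close>

text \<open>The flag \<open>b\<close> says whether the range is bounded above, so that all columns,
  including the last, are treated at once. With \<open>c = j\<close>, the exponent
  \<open>m' + Suc c\<close> is \<open>t_(j+1)\<close>, the first one beyond the range.\<close>

lemma has_sum_geometric_segment:
  fixes x :: real
  assumes "0 < x" "x < 1" "b \<Longrightarrow> m \<le> m'"
  shows "((\<lambda>k. x ^ (k + c)) has_sum (x ^ (m + c) - (if b then x ^ (m' + Suc c) else 0)) / (1 - x))
    {k. m \<le> k \<and> (b \<longrightarrow> k \<le> m')}"
proof (cases b)
  case True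
  have "{k. m \<le> k \<and> (b \<longrightarrow> k \<le> m')} = {m..m'}"
    using True by auto
  moreover have "(\<Sum>k=m..m'. x ^ (k + c)) = (x ^ (m + c) - x ^ (m' + Suc c)) / (1 - x)"
  proof -
    have "(\<Sum>k=m..m'. x ^ (k + c)) = (\<Sum>k=m..m'. x ^ k) * x ^ c"
      by (simp add: power_add sum_distrib_right)
    also have "\<dots> = (x ^ m - x ^ Suc m') / (1 - x) * x ^ c"
      using assms True by (simp add: sum_gp)
    finally show ?thesis
      by (simp add: power_add left_diff_distrib)
  qed
  ultimately show ?thesis
    using True by (intro has_sum_finiteI) auto
next
  case False
  have "((\<lambda>k. x ^ k) has_sum 1 / (1 - x)) UNIV"
    using assms geometric_sums[of x] summable_geometric[of x]
    by (intro norm_summable_imp_has_sum) (auto simp: norm_power)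
  then have "((\<lambda>k. x ^ (m + c) * x ^ k) has_sum x ^ (m + c) * (1 / (1 - x))) UNIV"
    by (rule has_sum_cmult_right)
  also have "?this \<longleftrightarrow> ((\<lambda>k. x ^ (k + c)) has_sum x ^ (m + c) * (1 / (1 - x))) {m..}"
    by (rule has_sum_reindex_bij_witness[of _ "\<lambda>k. k - m" "\<lambda>k. k + m"])
      (auto simp: power_add)
  finally show ?thesis
    using False by (simp add: atLeast_def)
qed

section \<open>Fillings with a prescribed main diagonal\<close>

text \<open>
  Row \<open>i \<ge> 1\<close> has \<open>a (i - 1) + 1\<close> cells: cells are numbered from 1 as in \<^const>\<open>shifted_diagram\<close>, but
  \<open>a\<close> and the prescribed diagonal \<open>d\<close> from 0, to match matrix indices.
\<close>

definition diag_shape :: "nat \<Rightarrow> (nat \<Rightarrow> nat) \<Rightarrow> (nat \<times> nat) set" where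
  "diag_shape n a = (SIGMA i:{1..n}. {i..i + a (i - 1)})"

definition diag_RPP :: "nat \<Rightarrow> (nat \<Rightarrow> nat) \<Rightarrow> (nat \<Rightarrow> nat) \<Rightarrow> (nat \<times> nat \<Rightarrow> nat) set" where
  "diag_RPP n a d = {T \<in> RPP (diag_shape n a). \<forall>i<n. T (Suc i, Suc i) = d i}"

text \<open>Equal positions are trivial. With strict inequality, the right cell of a row comparison
  and the upper cell of a column comparison lie off the main diagonal of a shifted shape.\<close>

lemma RPP_I:
  assumes "\<And>c. c \<notin> D \<Longrightarrow> T c = 0"
    and "\<And>i j j'. (i, j) \<in> D \<Longrightarrow> (i, j') \<in> D \<Longrightarrow> j < j' \<Longrightarrow> T (i, j) \<le> T (i, j')"
    and "\<And>i i' j. (i, j) \<in> D \<Longrightarrow> (i', j) \<in> D \<Longrightarrow> i < i' \<Longrightarrow> T (i, j) \<le> T (i', j)"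
  shows "T \<in> RPP D"
proof -
  have "T (i, j) \<le> T (i, j')" if "(i, j) \<in> D" "(i, j') \<in> D" "j \<le> j'" for i j j'
    using assms(2)[of i j j'] that by (cases "j = j'") auto
  moreover have "T (i, j) \<le> T (i', j)" if "(i, j) \<in> D" "(i', j) \<in> D" "i \<le> i'" for i i' j
    using assms(3)[of i j i'] that by (cases "i = i'") auto
  ultimately show ?thesis
    using assms(1) unfolding RPP_def by blast
qed

lemma RPP_zero: "T \<in> RPP D \<Longrightarrow> c \<notin> D \<Longrightarrow> T c = 0"
  by (cases c) (simp add: RPP_def)

lemma RPP_row: "T \<in> RPP D \<Longrightarrow> (i, j) \<in> D \<Longrightarrow> (i, j') \<in> D \<Longrightarrow> j \<le> j' \<Longrightarrow> T (i, j) \<le> T (i, j')"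
  unfolding RPP_def by blast

lemma RPP_column: "T \<in> RPP D \<Longrightarrow> (i, j) \<in> D \<Longrightarrow> (i', j) \<in> D \<Longrightarrow> i \<le> i' \<Longrightarrow> T (i, j) \<le> T (i', j)"
  unfolding RPP_def by blast

text \<open>As \<open>a\<close> decreases strictly, only its last value can be 0, and
  \<open>n'\<close> drops exactly that row.\<close>

lemma row_pos:
  fixes a :: "nat \<Rightarrow> nat"
  assumes decr: "\<And>i j. i < j \<Longrightarrow> j < n \<Longrightarrow> a j < a i"
    and n': "n' = (if n = 0 \<or> a (n - 1) = 0 then n - 1 else n)"
    and "i < n'"
  shows "0 < a i"
proof (cases "i = n - 1")
  case True
  then show ?thesis using \<open>i < n'\<close> n' by (auto split: if_splits)
next
  case False
  then have "i < n - 1" "n - 1 < n" using \<open>i < n'\<close> n' by (auto split: if_splits)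
  then show ?thesis using decr[of i "n - 1"] by simp
qed

lemma row_zero:
  fixes a :: "nat \<Rightarrow> nat"
  assumes n': "n' = (if n = 0 \<or> a (n - 1) = 0 then n - 1 else n)"
    and "n' \<le> i" "i < n"
  shows "a i = 0"
proof -
  from assms n' have "i = n - 1" "a (n - 1) = 0" by (auto split: if_splits)
  then show ?thesis by simp
qed

section \<open>Deleting and restoring the main diagonal\<close>

text \<open>
  \<open>n'\<close> rows and \<open>a'\<close> describe the shape left after deleting the main diagonal; \<open>I j\<close> is the range of
  the \<open>j\<close>-th entry of the new diagonal, unbounded above in the last of \<open>n\<close> rows.
\<close>

context
  fixes n n' :: nat and a a' d :: "nat \<Rightarrow> nat" and I :: "nat \<Rightarrow> nat set"
  assumes decr: "\<And>i j. i < j \<Longrightarrow> j < n \<Longrightarrow> a j < a i"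
    and n': "n' = (if n = 0 \<or> a (n - 1) = 0 then n - 1 else n)"
    and a': "a' = (\<lambda>i. a i - 1)"
    and I_def: "I = (\<lambda>j. {k. d j \<le> k \<and> (Suc j < n \<longrightarrow> k \<le> d (Suc j))})"
begin

text \<open>The cells off the diagonal move one column to the left, so that row \<open>i\<close>
  starts in column \<open>i\<close> again. It keeps \<open>a (i - 1)\<close> cells: this is
  \<open>a' (i - 1) + 1\<close> if the row survives and 0 if it is dropped.\<close>

lemma peeled_shape_iff:
  "(i, j) \<in> diag_shape n' a' \<longleftrightarrow> i \<le> j \<and> (i, Suc j) \<in> diag_shape n a"
proof -
  have "n' \<le> n" using n' by auto
  moreover have "a (i - 1) = 0" if "\<not> i \<le> n'" "i \<le> n"
    using row_zero[of n' n a "i - 1", OF n'] that by auto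
  moreover have "0 < a (i - 1)" if "1 \<le> i" "i \<le> n'"
    using row_pos[of n a n' "i - 1", OF decr n'] that by auto
  ultimately show ?thesis
    unfolding diag_shape_def a' by (cases "i \<le> n'") force+
qed

lemma diag_shape_cases:
  assumes "(i, j) \<in> diag_shape n a"
  obtains "j = i" "1 \<le> i" "i \<le> n"
  | k where "j = Suc k" "(i, k) \<in> diag_shape n' a'"
proof (cases "j = i")
  case True
  then show thesis using assms that(1) by (auto simp: diag_shape_def)
next
  case False
  then have "j = Suc (j - 1)" "i \<le> j - 1" using assms by (auto simp: diag_shape_def)
  then show thesis using assms that(2)[of "j - 1"] peeled_shape_iff[of i "j - 1"] by simp
qed

text \<open>Interlacing: an entry right of the diagonal is at least its left neighbour and at most
  the entry below it, and both of these are diagonal entries.\<close>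

lemma peel_mem:
  assumes T: "T \<in> diag_RPP n a d"
  shows "(\<lambda>i\<in>{..<n'}. T (Suc i, Suc (Suc i))) \<in> PiE {..<n'} I"
    and "(\<lambda>(i, j). if i \<le> j then T (i, Suc j) else 0) \<in>
      diag_RPP n' a' (\<lambda>i\<in>{..<n'}. T (Suc i, Suc (Suc i)))"
proof -
  have R: "T \<in> RPP (diag_shape n a)" and diag: "\<And>i. i < n \<Longrightarrow> T (Suc i, Suc i) = d i"
    using T by (auto simp: diag_RPP_def)
  have "T (Suc i, Suc (Suc i)) \<in> I i" if "i < n'" for i
  proof -
    have i: "i < n" "0 < a i" using that row_pos[of n a n' i, OF decr n'] n' by (auto split: if_splits)
    have "T (Suc i, Suc i) \<le> T (Suc i, Suc (Suc i))"
      by (rule RPP_row[OF R]) (use i in \<open>auto simp: diag_shape_def\<close>)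
    \<comment> \<open>If the last row is dropped, its diagonal entry still bounds the last entry of
      the new diagonal.\<close>
    moreover have "T (Suc i, Suc (Suc i)) \<le> T (Suc (Suc i), Suc (Suc i))" if "Suc i < n"
      by (rule RPP_column[OF R]) (use i that in \<open>auto simp: diag_shape_def\<close>)
    ultimately show ?thesis using diag[of i] diag[of "Suc i"] i by (auto simp: I_def)
  qed
  then show "(\<lambda>i\<in>{..<n'}. T (Suc i, Suc (Suc i))) \<in> PiE {..<n'} I" by auto
  show "(\<lambda>(i, j). if i \<le> j then T (i, Suc j) else 0) \<in>
      diag_RPP n' a' (\<lambda>i\<in>{..<n'}. T (Suc i, Suc (Suc i)))"
    (is "?T \<in> _")
  proof -
    have "?T \<in> RPP (diag_shape n' a')"
    proof (rule RPP_I)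
      fix c assume "c \<notin> diag_shape n' a'"
      then show "?T c = 0"
        by (cases c) (auto simp: peeled_shape_iff intro: RPP_zero[OF R])
    next
      fix i j j' assume "(i, j) \<in> diag_shape n' a'" "(i, j') \<in> diag_shape n' a'" "j < j'"
      then show "?T (i, j) \<le> ?T (i, j')"
        using RPP_row[OF R, of i "Suc j" "Suc j'"] by (simp add: peeled_shape_iff)
    next
      fix i i' j assume "(i, j) \<in> diag_shape n' a'" "(i', j) \<in> diag_shape n' a'" "i < i'"
      then show "?T (i, j) \<le> ?T (i', j)"
        using RPP_column[OF R, of i "Suc j" i'] by (simp add: peeled_shape_iff)
    qed
    then show ?thesis by (simp add: diag_RPP_def)
  qed
qed

text \<open>Only comparisons with a restored diagonal entry are new. In a row, \<open>low\<close>
  bounds it by the entry to its right; in a column, \<open>high\<close> bounds the entry above by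
  it. Monotonicity of \<open>T\<close> does the rest.\<close>

lemma unpeel_mem:
  assumes e: "e \<in> PiE {..<n'} I" and T: "T \<in> diag_RPP n' a' e"
  shows "(\<lambda>(i, j). if i = j \<and> 1 \<le> i \<and> i \<le> n then d (i - 1) else if i < j then T (i, j - 1) else 0)
    \<in> diag_RPP n a d"
    (is "?T \<in> _")
proof -
  let ?D = "diag_shape n a" and ?D' = "diag_shape n' a'"
  have R: "T \<in> RPP ?D'" and diag: "\<And>i. i < n' \<Longrightarrow> T (Suc i, Suc i) = e i"
    using T by (auto simp: diag_RPP_def)
  have low: "d (i - 1) \<le> T (i, i)" and high: "i < n \<Longrightarrow> T (i, i) \<le> d i" if "(i, i) \<in> ?D'" for i
  proof -
    have i: "1 \<le> i" "i \<le> n'" using that by (auto simp: diag_shape_def)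
    then have "T (i, i) \<in> I (i - 1)"
      using diag[of "i - 1"] e by (auto simp: PiE_def Pi_def)
    then show "d (i - 1) \<le> T (i, i)" "i < n \<Longrightarrow> T (i, i) \<le> d i"
      using i by (auto simp: I_def)
  qed
  have mem: "(i, k) \<in> ?D'" if "(i, l) \<in> ?D'" "i \<le> k" "k \<le> l" for i k l
    using that by (auto simp: diag_shape_def)
  have "?T \<in> RPP ?D"
  proof (rule RPP_I)
    fix c assume c: "c \<notin> ?D"
    obtain i j where ij: "c = (i, j)" by (cases c)
    have "T (i, j - 1) = 0" if "i < j"
      using c ij that by (intro RPP_zero[OF R]) (auto simp: peeled_shape_iff)
    then show "?T c = 0" using c ij by (auto simp: diag_shape_def)
  next
    fix i j j' assume a: "(i, j) \<in> ?D" "(i, j') \<in> ?D" "j < j'"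
    have "i \<le> j" using a by (auto simp: diag_shape_def)
    with a(2,3) obtain l where l: "j' = Suc l" "(i, l) \<in> ?D'"
      by (cases rule: diag_shape_cases) auto
    from a(1) show "?T (i, j) \<le> ?T (i, j')"
    proof (cases rule: diag_shape_cases)
      case 1
      have "d (i - 1) \<le> T (i, i)" using low mem[OF l(2)] l a 1 by auto
      also have "\<dots> \<le> T (i, l)"
        by (rule RPP_row[OF R mem[OF l(2)] l(2)]) (use l a 1 in auto)
      finally show ?thesis using 1 l a by auto
    next
      case (2 k)
      then show ?thesis
        using l a RPP_row[OF R 2(2) l(2)] by (auto simp: peeled_shape_iff)
    qed
  next
    fix i i' j assume a: "(i, j) \<in> ?D" "(i', j) \<in> ?D" "i < i'"
    have "i' \<le> j" using a by (auto simp: diag_shape_def)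
    with a(1,3) obtain k where k: "j = Suc k" "(i, k) \<in> ?D'"
      by (cases rule: diag_shape_cases) auto
    from a(2) show "?T (i, j) \<le> ?T (i', j)"
    proof (cases rule: diag_shape_cases)
      case 1
      have i: "1 \<le> i" "i \<le> k" "k < n"
        using a k 1 by (auto simp: diag_shape_def)
      \<comment> \<open>Row \<open>k\<close> is not the last one, so its value of \<open>a\<close>
        exceeds another and is positive. Hence column \<open>k\<close> of the smaller shape reaches
        down to \<open>(k, k)\<close>, where \<open>high\<close> applies.\<close>
      have "0 < a (k - 1)"
        using decr[of "k - 1" k] i by auto
      then have "(k, Suc k) \<in> ?D" using i by (auto simp: diag_shape_def)
      then have kk: "(k, k) \<in> ?D'" by (simp add: peeled_shape_iff)
      have "T (i, k) \<le> T (k, k)"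
        by (rule RPP_column[OF R k(2) kk]) (use i in auto)
      also have "\<dots> \<le> d k" using high[OF kk] i by auto
      finally show ?thesis using 1 k a i by auto
    next
      case (2 l)
      then show ?thesis
        using k a RPP_column[OF R k(2), of i'] by (auto simp: peeled_shape_iff)
    qed
  qed
  then show ?thesis by (auto simp: diag_RPP_def)
qed

lemma RPP_size_peel:
  assumes "T \<in> diag_RPP n a d"
  shows "RPP_size (diag_shape n a) T = (\<Sum>i<n. d i) +
    RPP_size (diag_shape n' a') (\<lambda>(i, j). if i \<le> j then T (i, Suc j) else 0)"
proof -
  let ?D = "diag_shape n a" and ?D' = "diag_shape n' a'"
  let ?A = "(\<lambda>i. (Suc i, Suc i)) ` {..<n}" and ?B = "(\<lambda>(i, j). (i, Suc j)) ` ?D'"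
  have D: "?D = ?A \<union> ?B"
  proof (intro equalityI subsetI)
    fix c assume "c \<in> ?D"
    then show "c \<in> ?A \<union> ?B"
    proof (cases c)
      case (Pair i j)
      with \<open>c \<in> ?D\<close> have "(i, j) \<in> ?D" by simp
      then show ?thesis
      proof (cases rule: diag_shape_cases)
        case 1
        then have "c = (Suc (i - 1), Suc (i - 1))" "i - 1 < n" using Pair by auto
        then show ?thesis by blast
      qed (use Pair in auto)
    qed
  qed (auto simp: peeled_shape_iff, simp add: diag_shape_def)
  have "?A \<inter> ?B = {}" by (auto simp: peeled_shape_iff)
  moreover have "finite ?D'" by (simp add: diag_shape_def)
  ultimately have "RPP_size ?D T = sum T ?A + sum T ?B"
    unfolding RPP_size_def D by (intro sum.union_disjoint) auto
  also have "sum T ?A = (\<Sum>i<n. d i)"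
    using assms by (subst sum.reindex) (auto simp: inj_on_def diag_RPP_def)
  also have "sum T ?B = RPP_size ?D' (\<lambda>(i, j). if i \<le> j then T (i, Suc j) else 0)"
    unfolding RPP_size_def
    by (subst sum.reindex) (auto simp: inj_on_def peeled_shape_iff intro!: sum.cong)
  finally show ?thesis .
qed

text \<open>Deleting the diagonal is a bijection onto the pairs of an interlacing diagonal
  \<open>e\<close> and a filling with diagonal \<open>e\<close>, and it splits off the constant
  weight of \<open>d\<close>. Summability over the pairs follows from positivity of the
  terms.\<close>

lemma has_sum_peel:
  fixes q :: real
  assumes "0 < q"
    and inner: "\<And>e. e \<in> PiE {..<n'} I \<Longrightarrow>
      ((\<lambda>T. q ^ RPP_size (diag_shape n' a') T) has_sum F e)
        (diag_RPP n' a' e)"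
    and outer: "(F has_sum S) (PiE {..<n'} I)"
  shows "((\<lambda>T. q ^ RPP_size (diag_shape n a) T) has_sum q ^ (\<Sum>i<n. d i) * S) (diag_RPP n a d)"
proof -
  let ?D' = "diag_shape n' a'"
  let ?B = "Sigma (PiE {..<n'} I) (diag_RPP n' a')"
  let ?peel = "\<lambda>T. (\<lambda>i\<in>{..<n'}. T (Suc i, Suc (Suc i)),
    \<lambda>(i, j). if i \<le> j then T (i, Suc j) else 0 :: nat)"
  let ?unpeel = "\<lambda>(e, T) (i, j). if i = j \<and> 1 \<le> i \<and> i \<le> n then d (i - 1)
    else if i < j then T (i, j - 1) else 0"
  have "((\<lambda>(e, T). q ^ RPP_size ?D' T) has_sum S) ?B"
  proof (rule has_sum_SigmaI)
    show "(\<lambda>(e, T). q ^ RPP_size ?D' T) summable_on ?B"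
      by (rule summable_on_SigmaI[OF _ has_sum_imp_summable[OF outer]])
        (use inner \<open>0 < q\<close> in auto)
  qed (use inner outer in auto)
  then have "((\<lambda>x. q ^ (\<Sum>i<n. d i) * (\<lambda>(e, T). q ^ RPP_size ?D' T) x) has_sum
      q ^ (\<Sum>i<n. d i) * S) ?B"
    by (rule has_sum_cmult_right)
  moreover have "((\<lambda>T. q ^ RPP_size (diag_shape n a) T) has_sum q ^ (\<Sum>i<n. d i) * S) (diag_RPP n a d)
    \<longleftrightarrow> ((\<lambda>x. q ^ (\<Sum>i<n. d i) * (\<lambda>(e, T). q ^ RPP_size ?D' T) x) has_sum
      q ^ (\<Sum>i<n. d i) * S) ?B"
  proof (rule has_sum_reindex_bij_witness[of _ ?unpeel ?peel])
    fix T assume T: "T \<in> diag_RPP n a d"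
    then show "?peel T \<in> ?B" using peel_mem by blast
    have zero: "T (i, j) = 0" if "(i, j) \<notin> diag_shape n a" for i j
      using T that by (auto simp: diag_RPP_def intro: RPP_zero)
    have diag: "T (i, i) = d (i - 1)" if "1 \<le> i" "i \<le> n" for i
      using T that by (cases i) (auto simp: diag_RPP_def)
    show "?unpeel (?peel T) = T"
    proof (rule ext)
      fix c show "?unpeel (?peel T) c = T c"
        by (cases c) (auto simp: diag zero diag_shape_def)
    qed
    show "q ^ (\<Sum>i<n. d i) * (\<lambda>(e, T). q ^ RPP_size ?D' T) (?peel T) =
        q ^ RPP_size (diag_shape n a) T"
      using RPP_size_peel[OF T] by (simp add: power_add)
  next
    fix x assume "x \<in> ?B"
    then obtain e T where x: "x = (e, T)" "e \<in> PiE {..<n'} I"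
      and T: "T \<in> diag_RPP n' a' e" by auto
    then show "?unpeel x \<in> diag_RPP n a d" using unpeel_mem by auto
    have "T (i, j) = 0" if "j < i" for i j
      using T that by (auto simp: diag_RPP_def diag_shape_def intro: RPP_zero)
    moreover have "e i = T (Suc i, Suc i)" if "i < n'" for i
      using T that by (auto simp: diag_RPP_def)
    \<comment> \<open>From \<open>n'\<close> on, \<open>e\<close> has the default value that the
      restriction in \<open>?peel\<close> assigns.\<close>
    moreover have "e i = undefined" if "\<not> i < n'" for i
      using x(2) that by (auto simp: PiE_def extensional_def)
    ultimately show "?peel (?unpeel x) = x"
      using x(1) by (auto simp: fun_eq_iff restrict_def)
  qed simp
  ultimately show ?thesis by blast
qed

end

section \<open>The closed form and its recursion\<close>

lemma prod_q_poch_step: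
  fixes q :: "'a :: comm_ring_1" and a :: "nat \<Rightarrow> nat"
  assumes "n' \<le> n" "\<And>i. i < n' \<Longrightarrow> 0 < a i" "\<And>i. n' \<le> i \<Longrightarrow> i < n \<Longrightarrow> a i = 0"
  shows "(\<Prod>i<n. q_poch q (a i)) = (\<Prod>i<n'. 1 - q ^ a i) * (\<Prod>i<n'. q_poch q (a i - 1))"
proof -
  have "(\<Prod>i<n. q_poch q (a i)) = (\<Prod>i<n'. q_poch q (a i))"
  proof (rule prod.mono_neutral_right)
    show "{..<n'} \<subseteq> {..<n}" using assms(1) by auto
    show "\<forall>i\<in>{..<n} - {..<n'}. q_poch q (a i) = 1" using assms(3) by (simp add: q_poch_def)
  qed simp
  also have "\<dots> = (\<Prod>i<n'. (1 - q ^ a i) * q_poch q (a i - 1))"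
  proof (rule prod.cong)
    fix i assume "i \<in> {..<n'}"
    then obtain k where "a i = Suc k" using assms(2)[of i] by (cases "a i") auto
    then show "q_poch q (a i) = (1 - q ^ a i) * q_poch q (a i - 1)"
      by (simp add: q_poch_def mult.commute)
  qed simp
  finally show ?thesis by (simp add: prod.distrib)
qed

text \<open>The closed form of the generating function, with \<open>t_j = d j + j\<close>. Row
  \<open>i + 1\<close> has \<open>a i + 1\<close> cells, so the exponent in the denominator is
  \<open>b\<close> of the sequence of row lengths.\<close>

definition diag_gf :: "real \<Rightarrow> nat \<Rightarrow> (nat \<Rightarrow> nat) \<Rightarrow> (nat \<Rightarrow> nat) \<Rightarrow> real" where
  "diag_gf q n a d = q ^ (\<Sum>j<n. d j + j) * det (mat n n (\<lambda>(i, j). q ^ ((d j + j) * a i))) /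
    (q ^ (\<Sum>i<n. i * (a i + 1)) * (\<Prod>i<n. q_poch q (a i)))"

text \<open>The closed form satisfies the recursion given by deleting the diagonal. Only the
  \<open>n'\<close> surviving rows enter the geometric sums, so every ratio \<open>q ^ a i\<close>
  is below 1.\<close>

lemma diag_gf_step:
  fixes q :: real
  assumes q: "0 < q" "q < 1"
    and decr: "\<And>i j. i < j \<Longrightarrow> j < n \<Longrightarrow> a j < a i"
    and n': "n' = (if n = 0 \<or> a (n - 1) = 0 then n - 1 else n)"
    and a': "a' = (\<lambda>i. a i - 1)"
    and I_def: "I = (\<lambda>j. {k. d j \<le> k \<and> (Suc j < n \<longrightarrow> k \<le> d (Suc j))})"
    and incr: "\<And>i. Suc i < n \<Longrightarrow> d i \<le> d (Suc i)"
  obtains S where "(diag_gf q n' a' has_sum S) (PiE {..<n'} I)" "q ^ (\<Sum>i<n. d i) * S = diag_gf q n a d"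
proof -
  have n'_le: "n' \<le> n" using n' by auto
  have pos: "0 < a i" if "i < n'" for i
    using row_pos[of n a n', OF decr n' that] .
  have zero: "a i = 0" if "n' \<le> i" "i < n" for i
    using row_zero[of n' n a, OF n' that] .
  define f where "f i j = q ^ ((d j + j) * a i)" for i j
  define s where "s i j = (f i j - (if Suc j < n then f i (Suc j) else 0)) / (1 - q ^ a i)" for i j
  \<comment> \<open>\<open>C\<close> is the denominator of \<open>diag_gf q n' a' e\<close>; it does
    not depend on \<open>e\<close>.\<close>
  define C where "C = q ^ (\<Sum>i<n'. i * (a' i + 1)) * (\<Prod>i<n'. q_poch q (a' i))"
  have pow: "q ^ (k * a i) = (q ^ a i) ^ k" for k i
    by (metis mult.commute power_mult)
  have "((\<lambda>k. q ^ ((k + j) * a i)) has_sum s i j) (I j)" if "i < n'" "j < n'" for i j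
  proof -
    have "0 < q ^ a i" "q ^ a i < 1"
      using q pos[OF that(1)] by (auto intro: power_Suc_less_one simp: power_less_one_iff)
    from has_sum_geometric_segment[OF this, of "Suc j < n" "d j" "d (Suc j)" j] show ?thesis
      using incr[of j] by (cases "Suc j < n") (simp_all add: s_def f_def I_def pow del: power_Suc mult_Suc)
  qed
  then have "((\<lambda>e. det (mat n' n' (\<lambda>(i, j). q ^ ((e j + j) * a i)))) has_sum
      det (mat n' n' (\<lambda>(i, j). s i j))) (PiE {..<n'} I)"
    by (rule has_sum_det_columns) (use q in auto)
  then have "((\<lambda>e. det (mat n' n' (\<lambda>(i, j). q ^ ((e j + j) * a i))) / C) has_sum
      det (mat n' n' (\<lambda>(i, j). s i j)) / C) (PiE {..<n'} I)"
    by (rule has_sum_divide_const)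
  moreover have "det (mat n' n' (\<lambda>(i, j). q ^ ((e j + j) * a i))) / C = diag_gf q n' a' e" for e
  proof -
    \<comment> \<open>The prefactor of \<open>diag_gf\<close> is distributed over the columns; it
      raises each exponent \<open>a' i\<close> to \<open>a' i + 1 = a i\<close>.\<close>
    have "mat n' n' (\<lambda>(i, j). q ^ ((e j + j) * a i)) =
        mat n' n' (\<lambda>(i, j). 1 * q ^ (e j + j) * q ^ ((e j + j) * a' i))"
    proof (rule eq_matI, simp_all, goal_cases)
      case (1 i j)
      then have "(e j + j) * a i = (e j + j) + (e j + j) * a' i"
        using pos[of i] by (cases "a i") (auto simp: a')
      then show ?case by (simp add: power_add)
    qed
    then have "det (mat n' n' (\<lambda>(i, j). q ^ ((e j + j) * a i))) =
        q ^ (\<Sum>j<n'. e j + j) * det (mat n' n' (\<lambda>(i, j). q ^ ((e j + j) * a' i)))"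
      by (simp only: det_scale) (simp add: power_sum)
    then show ?thesis by (simp add: diag_gf_def C_def)
  qed
  ultimately have sum: "(diag_gf q n' a' has_sum det (mat n' n' (\<lambda>(i, j). s i j)) / C) (PiE {..<n'} I)"
    by simp
  have "mat n' n' (\<lambda>(i, j). s i j) = mat n' n' (\<lambda>(i, j). inverse (1 - q ^ a i) * 1 *
      (f i j - (if Suc j < n then f i (Suc j) else 0)))"
    by (auto simp: s_def divide_inverse mult.commute)
  then have "det (mat n' n' (\<lambda>(i, j). s i j)) = (\<Prod>i<n'. inverse (1 - q ^ a i)) *
      det (mat n' n' (\<lambda>(i, j). f i j - (if Suc j < n then f i (Suc j) else 0)))"
    by (simp only: det_scale) simp
  also have "det (mat n' n' (\<lambda>(i, j). f i j - (if Suc j < n then f i (Suc j) else 0))) =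
      det (mat n n (\<lambda>(i, j). f i j))"
  proof (cases "n' = n")
    case True
    then show ?thesis by (simp only: det_diff_next_column)
  next
    case False
    then have n: "n = Suc n'" using n' by (auto split: if_splits)
    have "mat n' n' (\<lambda>(i, j). f i j - (if Suc j < n then f i (Suc j) else 0)) =
        mat n' n' (\<lambda>(i, j). f i j - f i (Suc j))"
      using n by auto
    moreover have "f n' j = 1" for j using zero[of n'] n by (simp add: f_def)
    ultimately show ?thesis using n by (simp add: det_diff_next_column_last_row)
  qed
  finally have det: "det (mat n' n' (\<lambda>(i, j). s i j)) =
      det (mat n n (\<lambda>(i, j). f i j)) / (\<Prod>i<n'. 1 - q ^ a i)"
    by (simp add: prod_inversef[unfolded comp_def] divide_inverse mult.commute)
  \<comment> \<open>The extra \<open>\<Sum>i<n. i\<close> in \<open>expo\<close> cancels against the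
    summands \<open>j\<close> of \<open>d j + j\<close>, which leaves the weight of the diagonal
    \<open>d\<close>.\<close>
  have "(\<Sum>i<n'. i * (a' i + 1)) = (\<Sum>i<n'. i * a i)"
    by (intro sum.cong) (use pos in \<open>auto simp: a'\<close>)
  also have "\<dots> = (\<Sum>i<n. i * a i)"
    by (rule sum.mono_neutral_left) (use n'_le zero in auto)
  finally have expo: "(\<Sum>i<n. i * (a i + 1)) = (\<Sum>i<n'. i * (a' i + 1)) + (\<Sum>i<n. i)"
    by (simp add: sum.distrib)
  have poch: "(\<Prod>i<n. q_poch q (a i)) = (\<Prod>i<n'. 1 - q ^ a i) * (\<Prod>i<n'. q_poch q (a' i))"
    unfolding a' by (rule prod_q_poch_step) (use n'_le pos zero in auto)
  have "q ^ (\<Sum>i<n. d i) * (det (mat n' n' (\<lambda>(i, j). s i j)) / C) = diag_gf q n a d"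
    unfolding det C_def diag_gf_def poch expo f_def
    using q by (simp add: sum.distrib power_add)
  with sum show thesis by (rule that)
qed

text \<open>Induction on the number of cells, which drops by \<open>n\<close> when the diagonal is
  deleted. For \<open>n = 0\<close> there is only the zero filling, and the empty determinant is
  1.\<close>

lemma has_sum_diag_RPP:
  fixes q :: real
  assumes q: "0 < q" "q < 1"
    and "\<And>i j. i < j \<Longrightarrow> j < n \<Longrightarrow> a j < a i"
    and "\<And>i. Suc i < n \<Longrightarrow> d i \<le> d (Suc i)"
  shows "((\<lambda>T. q ^ RPP_size (diag_shape n a) T) has_sum diag_gf q n a d) (diag_RPP n a d)"
  using assms(3,4)
proof (induction "\<Sum>i<n. a i + 1" arbitrary: n a d rule: less_induct)
  case less
  define n' where "n' = (if n = 0 \<or> a (n - 1) = 0 then n - 1 else n)"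
  define a' where "a' = (\<lambda>i. a i - 1)"
  define I where "I = (\<lambda>j. {k. d j \<le> k \<and> (Suc j < n \<longrightarrow> k \<le> d (Suc j))})"
  note defs = less.prems(1) n'_def a'_def I_def
  have n'_le: "n' \<le> n" using n'_def by auto
  have pos: "0 < a i" if "i < n'" for i
    using row_pos[of n a n', OF defs(1,2) that] .
  show ?case
  proof (cases "n = 0")
    case True
    then have "diag_RPP n a d = {\<lambda>_. 0}"
      by (auto simp: diag_RPP_def diag_shape_def RPP_def)
    then show ?thesis
      using True by (auto simp: diag_gf_def RPP_size_def diag_shape_def intro!: has_sum_finiteI)
  next
    case False
    obtain S where S: "(diag_gf q n' a' has_sum S) (PiE {..<n'} I)"
        "q ^ (\<Sum>i<n. d i) * S = diag_gf q n a d"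
      using diag_gf_step[of q n a n' a' I d, OF q defs less.prems(2)] .
    have "((\<lambda>T. q ^ RPP_size (diag_shape n' a') T) has_sum diag_gf q n' a' e) (diag_RPP n' a' e)"
      if e: "e \<in> PiE {..<n'} I" for e
    proof (rule less.hyps)
      have "(\<Sum>i<n'. a' i + 1) = (\<Sum>i<n'. a i)"
        by (intro sum.cong) (use pos in \<open>auto simp: a'_def\<close>)
      also have "\<dots> \<le> (\<Sum>i<n. a i)"
        using n'_le by (intro sum_mono2) auto
      also have "\<dots> < (\<Sum>i<n. a i + 1)"
        using False by (simp only: sum.distrib) simp
      finally show "(\<Sum>i<n'. a' i + 1) < (\<Sum>i<n. a i + 1)" .
      \<comment> \<open>Truncated subtraction keeps the inequality strict because surviving rows
        have positive \<open>a\<close>.\<close>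
      show "a' j < a' i" if "i < j" "j < n'" for i j
        using less.prems(1)[of i j] pos[of j] that n'_le by (simp add: a'_def)
      \<comment> \<open>Consecutive ranges meet at \<open>d (Suc i)\<close>, which separates
        \<open>e i\<close> from \<open>e (Suc i)\<close>.\<close>
      show "e i \<le> e (Suc i)" if "Suc i < n'" for i
      proof -
        have "e i \<in> I i" "e (Suc i) \<in> I (Suc i)"
          using e that by (auto simp: PiE_def Pi_def)
        then show ?thesis using that n'_le by (auto simp: I_def)
      qed
    qed
    from has_sum_peel[of n a n' a' I d, OF defs q(1) this S(1)] show ?thesis
      by (simp add: S(2))
  qed
qed

section \<open>From the determinant to the Schur polynomial\<close>

text \<open>With the columns reversed, the denominator of the bialternant becomes
  \<open>vandermonde_bar n x\<close> with the right sign. The reversal factor \<open>c\<close> then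
  passes to the numerator; distinctness makes the denominator nonzero.\<close>

lemma schur_times_vandermonde_bar:
  fixes x :: "nat \<Rightarrow> 'a :: field"
  assumes "inj_on x {1..n}"
  shows "schur n lam x * vandermonde_bar n x =
    det (mat n n (\<lambda>(i, j). x (n - j) ^ (lam (i + 1) + n - (i + 1))))"
proof -
  obtain c :: 'a where c:
    "\<And>f. det (mat n n (\<lambda>(i, j). f i (n - 1 - j))) = c * det (mat n n (\<lambda>(i, j). f i j))"
    using det_reverse_columns[of n] by blast
  have rev: "det (mat n n (\<lambda>(i, j). x (n - j) ^ k i)) = c * det (mat n n (\<lambda>(i, j). x (j + 1) ^ k i))"
    for k :: "nat \<Rightarrow> nat"
  proof -
    have "mat n n (\<lambda>(i, j). x (n - j) ^ k i) = mat n n (\<lambda>(i, j). x (n - 1 - j + 1) ^ k i)"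
      by (rule eq_matI) (auto simp: Suc_diff_Suc)
    then show ?thesis
      using c[of "\<lambda>i j. x (j + 1) ^ k i"] by simp
  qed
  have V: "vandermonde_bar n x = (\<Prod>j<n. \<Prod>i<j. x (n - i) - x (n - j))"
    unfolding vandermonde_bar_def
    by (subst prod.Sigma) (auto intro!: prod.reindex_bij_witness
      [of _ "\<lambda>(j, i). (n - j, n - i)" "\<lambda>(i, j). (n - i, n - j)"])
  also have "\<dots> = det (mat n n (\<lambda>(i, j). x (n - j) ^ (n - 1 - i)))"
    by (rule det_vandermonde[symmetric])
  also have "\<dots> = c * det (mat n n (\<lambda>(i, j). x (j + 1) ^ (n - (i + 1))))"
    using rev[of "\<lambda>i. n - 1 - i"] by simp
  finally have "vandermonde_bar n x = \<dots>" .
  moreover have "vandermonde_bar n x \<noteq> 0"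
    unfolding V using assms by (auto simp: inj_on_eq_iff)
  ultimately show ?thesis
    by (simp add: schur_def rev[of "\<lambda>i. lam (i + 1) + n - (i + 1)", simplified])
qed

theorem theorem8p7:
  fixes q :: real and n :: nat and lam mu :: "nat \<Rightarrow> nat"
  assumes "0 < q" and "q < 1" and "n \<ge> 1"
    and "lam \<in> partitions n" and "mu \<in> partitions n"
  shows "((\<lambda>T. q ^ RPP_size (shifted_diagram n lam) T) has_sum
          (q powi (- int (seq_b n (\<lambda>i. delta (n + 1) i + lam i))) /
             (\<Prod>j=1..n. q_poch q (lam j + n - j)) *
           q ^ seq_size n (\<lambda>i. mu i + delta n i) *
           schur n lam (\<lambda>i. q ^ (mu i + delta n i)) *
           vandermonde_bar n (\<lambda>i. q ^ (mu i + delta n i))))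
         {T \<in> RPP (shifted_diagram n lam). rdiag n T = mu}"
proof -
  define a where "a = (\<lambda>i. lam (i + 1) + n - (i + 1))"
  \<comment> \<open>\<open>rdiag\<close> reads the diagonal from the bottom, \<open>d\<close> from
    the top.\<close>
  define d where "d = (\<lambda>j. mu (n - j))"
  define x where "x = (\<lambda>i. q ^ (mu i + delta n i))"
  have lam_mono: "lam j \<le> lam i" and mu_mono: "mu j \<le> mu i"
    if "1 \<le> i" "i \<le> j" "j \<le> n" for i j
    using assms(4,5) that by (auto simp: partitions_def)
  have decr: "a j < a i" if "i < j" "j < n" for i j
    using lam_mono[of "i + 1" "j + 1"] that by (simp add: a_def)
  have incr: "d i \<le> d (Suc i)" if "Suc i < n" for i
    using mu_mono[of "n - Suc i" "n - i"] that by (simp add: d_def)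
  have shape: "shifted_diagram n lam = diag_shape n a"
    by (auto simp: shifted_diagram_def diag_shape_def a_def)
  have "rdiag n T = mu \<longleftrightarrow> (\<forall>i<n. T (Suc i, Suc i) = d i)" for T
  proof
    assume T: "rdiag n T = mu"
    show "\<forall>i<n. T (Suc i, Suc i) = d i"
    proof (intro allI impI)
      fix i assume "i < n"
      then have "n + 1 - (n - i) = Suc i" "n - i \<in> {1..n}" by auto
      then show "T (Suc i, Suc i) = d i"
        using fun_cong[OF T, of "n - i"] by (simp add: rdiag_def d_def)
    qed
  next
    assume T: "\<forall>i<n. T (Suc i, Suc i) = d i"
    show "rdiag n T = mu"
    proof
      fix i show "rdiag n T i = mu i"
      proof (cases "i \<in> {1..n}")
        case True
        then have "n + 1 - i = Suc (n - i)" "n - (n - i) = i" "n - i < n" by auto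
        then show ?thesis using T True by (simp add: rdiag_def d_def)
      next
        case False
        then show ?thesis using assms(5) by (auto simp: rdiag_def partitions_def)
      qed
    qed
  qed
  then have set: "{T \<in> RPP (shifted_diagram n lam). rdiag n T = mu} = diag_RPP n a d"
    by (simp add: diag_RPP_def shape)
  have "inj_on x {1..n}"
  proof (rule linorder_inj_onI)
    fix i j assume "i < j" "i \<in> {1..n}" "j \<in> {1..n}"
    then have "mu j + delta n j < mu i + delta n i"
      using mu_mono[of i j] by (auto simp: delta_def)
    then show "x i \<noteq> x j"
      using power_strict_decreasing[OF _ assms(1,2)] by (fastforce simp: x_def)
  qed auto
  then have "schur n lam x * vandermonde_bar n x =
      det (mat n n (\<lambda>(i, j). x (n - j) ^ (lam (i + 1) + n - (i + 1))))"
    by (rule schur_times_vandermonde_bar)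
  \<comment> \<open>Here \<open>delta n (n - j) = j\<close>, so \<open>x (n - j)\<close> is
    \<open>q ^ (d j + j)\<close>.\<close>
  also have "mat n n (\<lambda>(i, j). x (n - j) ^ (lam (i + 1) + n - (i + 1))) =
      mat n n (\<lambda>(i, j). q ^ ((d j + j) * a i))"
    by (rule eq_matI) (auto simp: x_def d_def a_def delta_def power_mult)
  finally have det: "det (mat n n (\<lambda>(i, j). q ^ ((d j + j) * a i))) =
      schur n lam x * vandermonde_bar n x" ..
  have size: "(\<Sum>j<n. d j + j) = seq_size n (\<lambda>i. mu i + delta n i)"
    unfolding seq_size_def
    by (rule sum.reindex_bij_witness[of _ "\<lambda>i. n - i" "\<lambda>j. n - j"]) (auto simp: d_def delta_def)
  have b: "(\<Sum>i<n. i * (a i + 1)) = seq_b n (\<lambda>i. delta (n + 1) i + lam i)"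
  proof -
    have "delta (Suc n) (Suc i) + lam (Suc i) = Suc (a i)" if "i < n" for i
      using that by (simp add: a_def delta_def)
    then show ?thesis
      unfolding seq_b_def by (intro sum.reindex_bij_witness[of _ "\<lambda>i. i - 1" Suc]) auto
  qed
  have poch: "(\<Prod>i<n. q_poch q (a i)) = (\<Prod>j=1..n. q_poch q (lam j + n - j))"
    by (rule prod.reindex_bij_witness[of _ "\<lambda>i. i - 1" Suc]) (auto simp: a_def)
  have "diag_gf q n a d = q powi (- int (seq_b n (\<lambda>i. delta (n + 1) i + lam i))) /
      (\<Prod>j=1..n. q_poch q (lam j + n - j)) * q ^ seq_size n (\<lambda>i. mu i + delta n i) *
      schur n lam x * vandermonde_bar n x"
    unfolding diag_gf_def det size b poch by (simp add: power_int_minus divide_inverse ac_simps)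
  moreover have "((\<lambda>T. q ^ RPP_size (diag_shape n a) T) has_sum diag_gf q n a d) (diag_RPP n a d)"
    by (rule has_sum_diag_RPP) (fact assms(1,2) decr incr)+
  ultimately show ?thesis
    unfolding set unfolding shape x_def by simp
qed

end
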